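(* Let $k$ be any field and let $k(x_1,x_2)$ be the rational function field in two variables over $k$. Let $\sigma : k(x_1,x_2)\longrightarrow k(x_1,x_2)$ be the $k$-automorphism defined by $$\sigma(x_1)=\frac{-x_1(3x_1-9x_2-x_2^2)^3}{(27x_1+2x_1^2+9x_1x_2+2x_1x_2^2-x_2^3)^2},$$ $$\sigma(x_2)=\frac{-(3x_1+x_2^2)(3x_1-9x_2-x_2^2)}{27x_1+2x_1^2+9x_1x_2+2x_1x_2^2-x_2^3}.$$ Then the fixed field $k(x_1,x_2)^{\langle\sigma\rangle}:=\{f\in k(x_1,x_2) : \sigma(f)=f\}$ is rational over $k$.
   Context: A field extension $L$ of $k$ is called rational over $k$ if it is purely transcendental over $k$, i.e. $L$ is generated over $k$ by a set of elements that are algebraically independent over $k$. The field $k$ is arbitrary: it is not assumed to be algebraically closed, and there is no restriction on its characteristic (integer coefficients in the formulas are interpreted via their images in $k$). A $k$-automorphism of $k(x_1,x_2)$ is a field automorphism of $k(x_1,x_2)$ that is the identity on $k$. *)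

theory Defs
  imports
    "HOL-Library.Poly_Mapping"
    "HOL-Computational_Algebra.Polynomial"
    "HOL-Computational_Algebra.Fraction_Field"
begin

section \<open>Subfields of an ambient field and rational extensions\<close>

definition subfield :: "'a::field set \<Rightarrow> bool" where
  "subfield F \<longleftrightarrow>
     0 \<in> F \<and> 1 \<in> F \<and>
     (\<forall>x\<in>F. \<forall>y\<in>F. x + y \<in> F \<and> x * y \<in> F) \<and>
     (\<forall>x\<in>F. - x \<in> F \<and> inverse x \<in> F)"

definition field_adjoin :: "'a::field set \<Rightarrow> 'a set \<Rightarrow> 'a set" where
  "field_adjoin K S = subfield hull (K \<union> S)"

text \<open>
  A polynomial in indeterminates indexed by a set of field elements is a finitely supported
  map from monomials to coefficients, a monomial being a finitely supported map from
  indeterminates to exponents.  The function below substitutes for each indeterminate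
  the field element that indexes it.
\<close>

definition eval_at_indices :: "(('a::field \<Rightarrow>\<^sub>0 nat) \<Rightarrow>\<^sub>0 'a) \<Rightarrow> 'a" where
  "eval_at_indices p =
     (\<Sum>m\<in>Poly_Mapping.keys p.
        Poly_Mapping.lookup p m *
        (\<Prod>s\<in>Poly_Mapping.keys m. s ^ Poly_Mapping.lookup m s))"

definition algebraically_independent :: "'a::field set \<Rightarrow> 'a set \<Rightarrow> bool" where
  "algebraically_independent K S \<longleftrightarrow>
     (\<forall>p :: ('a \<Rightarrow>\<^sub>0 nat) \<Rightarrow>\<^sub>0 'a.
        (\<forall>m. Poly_Mapping.lookup p m \<in> K) \<longrightarrow>
        (\<forall>m\<in>Poly_Mapping.keys p. Poly_Mapping.keys m \<subseteq> S) \<longrightarrow>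
        eval_at_indices p = 0 \<longrightarrow> p = 0)"

definition rational_over :: "'a::field set \<Rightarrow> 'a set \<Rightarrow> bool" where
  "rational_over K L \<longleftrightarrow> (\<exists>S. algebraically_independent K S \<and> L = field_adjoin K S)"

text \<open>
  A bijection that preserves sums and products also preserves 0 and 1, so these need not
  be required separately.
\<close>

definition field_automorphism_over :: "'a::field set \<Rightarrow> ('a \<Rightarrow> 'a) \<Rightarrow> bool" where
  "field_automorphism_over K \<sigma> \<longleftrightarrow>
     bij \<sigma> \<and>
     (\<forall>f g. \<sigma> (f + g) = \<sigma> f + \<sigma> g) \<and>
     (\<forall>f g. \<sigma> (f * g) = \<sigma> f * \<sigma> g) \<and>
     (\<forall>c\<in>K. \<sigma> c = c)"

section \<open>The rational function field in two variables\<close>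

text \<open>
  For a field \<^typ>\<open>'k\<close>, the type \<^typ>\<open>'k::field poly poly fract\<close> is the fraction field of
  $k[x_1][x_2]$: the inner polynomial variable is $x_1$ and the outer one is $x_2$.
\<close>

definition constants :: "'k::field poly poly fract set" where
  "constants = range (\<lambda>c. Fract [:[:c:]:] 1)"

definition x1 :: "'k::field poly poly fract" where
  "x1 = Fract [:[:0, 1:]:] 1"

definition x2 :: "'k::field poly poly fract" where
  "x2 = Fract [:0, 1:] 1"

end

theory Submission
  imports Defs "HOL-Computational_Algebra.Polynomial_Factorial"
begin

text \<open>
  Put $b = x_1/x_2^2$ and $c = x_2/x_1$.  Then $x_1 = 1/(bc^2)$ and $x_2 = 1/(bc)$, so that
  $k(x_1,x_2) = k(b,c)$, and the point of this change of variables is that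
  \[ \sigma(b) = \frac{9b^2c + b - 3b^2}{(3b+1)^2} \]
  is linear in $c$, with leading coefficient divisible by 9.

  If the characteristic is not 3, this can be solved for $c$, hence $k(x_1,x_2) = k(b,\sigma(b))$.
  Since $\sigma$ has order 2, it merely interchanges these two generators, and its fixed field
  is $k(b + \sigma(b), b\sigma(b))$ like that of any transposition of two variables.  If the
  characteristic is 3, the formula collapses to $\sigma(b) = b$, and one finds
  $\sigma(c) = 2b + 2 - c$; the fixed field is then $k(b, c\,\sigma(c))$.

  In both cases the candidate field $F$ consists of fixed elements and contains the trace and norm
  of an element $z \neq \sigma(z)$ with $F(z) = k(x_1,x_2)$.  Everything is then of the form
  $p + qz$ with $p, q \in F$, and $\sigma(p + qz) = p + qz$ forces $q = 0$, which gives that $F$ is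
  the whole fixed field (lemma \<open>fixed_field_of_involution\<close>).

  What remains is the algebraic independence of the two generators of $F$.  They are reached from
  $x_1, x_2$ by a chain of steps, each of which replaces one element $v$ of a pair $u, v$ by
  $1/v$, by a nonconstant polynomial in $v$ with coefficients in $k[u]$, or by the quotient of $v$
  by a nonzero element of $k[u]$; between steps the pair may be swapped.  These steps preserve independence, because an element $v$ that is
  transcendental over a ring has transcendental inverse and transcendental polynomial expressions.
\<close>

section \<open>Polynomials with coefficients in a subring\<close>

definition subring :: "'a::comm_ring_1 set \<Rightarrow> bool" where
  "subring R \<longleftrightarrow> 1 \<in> R \<and> (\<forall>x\<in>R. - x \<in> R) \<and> (\<forall>x\<in>R. \<forall>y\<in>R. x + y \<in> R \<and> x * y \<in> R)"

definition coeffs_in :: "'a::zero set \<Rightarrow> 'a poly \<Rightarrow> bool" where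
  "coeffs_in R p \<longleftrightarrow> (\<forall>i. coeff p i \<in> R)"

definition ring_adjoin :: "'a::comm_ring_1 set \<Rightarrow> 'a \<Rightarrow> 'a set" where
  "ring_adjoin R u = {poly p u | p. coeffs_in R p}"

lemma subringD:
  assumes "subring R"
  shows "0 \<in> R" "1 \<in> R" "x \<in> R \<Longrightarrow> - x \<in> R" "x \<in> R \<Longrightarrow> y \<in> R \<Longrightarrow> x + y \<in> R"
    "x \<in> R \<Longrightarrow> y \<in> R \<Longrightarrow> x - y \<in> R" "x \<in> R \<Longrightarrow> y \<in> R \<Longrightarrow> x * y \<in> R" "x \<in> R \<Longrightarrow> x ^ n \<in> R"
proof -
  have "1 + - 1 \<in> R"
    using assms unfolding subring_def by blast
  then show "0 \<in> R" by simp
  show "1 \<in> R" "x \<in> R \<Longrightarrow> - x \<in> R" "x \<in> R \<Longrightarrow> y \<in> R \<Longrightarrow> x + y \<in> R"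
    "x \<in> R \<Longrightarrow> y \<in> R \<Longrightarrow> x * y \<in> R"
    using assms by (auto simp: subring_def)
  show "x \<in> R \<Longrightarrow> x ^ n \<in> R"
    using assms by (induction n) (auto simp: subring_def)
  assume "x \<in> R" "y \<in> R"
  then have "x + - y \<in> R"
    using assms unfolding subring_def by blast
  then show "x - y \<in> R" by simp
qed

lemma subring_numeral:
  assumes "subring R"
  shows "numeral n \<in> R"
proof -
  have "of_nat m \<in> R" for m
    by (induction m) (auto intro: subringD[OF assms])
  from this[of "numeral n"] show ?thesis by simp
qed

lemma subring_sum:
  assumes "subring R" "\<And>i. i \<in> I \<Longrightarrow> f i \<in> R"
  shows "sum f I \<in> R"
  using assms(2) by (induction I rule: infinite_finite_induct) (auto intro: subringD[OF assms(1)])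

lemma coeffs_in_const: "subring R \<Longrightarrow> a \<in> R \<Longrightarrow> coeffs_in R [:a:]"
  by (auto simp: coeffs_in_def coeff_pCons subringD split: nat.splits)

lemma coeffs_in_pCons: "a \<in> R \<Longrightarrow> coeffs_in R p \<Longrightarrow> coeffs_in R (pCons a p)"
  by (auto simp: coeffs_in_def coeff_pCons split: nat.splits)

lemma coeffs_in_pcompose:
  assumes "subring R" "coeffs_in R p" "coeffs_in R q"
  shows "coeffs_in R (pcompose p q)"
  using assms(2,3) unfolding coeffs_in_def
  by (intro allI coeff_pcompose_semiring_closed) (auto intro: subringD[OF assms(1)])

lemma ring_adjoin_mem:
  assumes "subring R"
  shows "a \<in> R \<Longrightarrow> a \<in> ring_adjoin R u" "u \<in> ring_adjoin R u"
proof -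
  show "a \<in> ring_adjoin R u" if "a \<in> R"
    unfolding ring_adjoin_def using coeffs_in_const[OF assms that]
    by (intro CollectI exI[of _ "[:a:]"]) auto
  show "u \<in> ring_adjoin R u"
    unfolding ring_adjoin_def
    using coeffs_in_pCons[OF subringD(1)[OF assms] coeffs_in_const[OF assms subringD(2)[OF assms]]]
    by (intro CollectI exI[of _ "[:0, 1:]"]) auto
qed

lemma subring_ring_adjoin:
  assumes "subring R"
  shows "subring (ring_adjoin R u)"
  unfolding subring_def
proof (intro conjI ballI)
  show "1 \<in> ring_adjoin R u"
    using ring_adjoin_mem(1)[OF assms] subringD(2)[OF assms] by blast
next
  fix x assume "x \<in> ring_adjoin R u"
  then obtain p where p: "x = poly p u" "coeffs_in R p"
    by (auto simp: ring_adjoin_def)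
  then show "- x \<in> ring_adjoin R u"
    unfolding ring_adjoin_def coeffs_in_def
    by (intro CollectI exI[of _ "- p"]) (auto intro: subringD[OF assms])
  fix y assume "y \<in> ring_adjoin R u"
  then obtain q where q: "y = poly q u" "coeffs_in R q"
    by (auto simp: ring_adjoin_def)
  show "x + y \<in> ring_adjoin R u"
    using p q unfolding ring_adjoin_def coeffs_in_def
    by (intro CollectI exI[of _ "p + q"]) (auto intro: subringD[OF assms])
  have "coeff (p * q) i \<in> R" for i
    using p(2) q(2) unfolding coeffs_in_def
    by (intro coeff_mult_semiring_closed) (auto intro: subringD[OF assms])
  then show "x * y \<in> ring_adjoin R u"
    using p q unfolding ring_adjoin_def coeffs_in_def
    by (intro CollectI exI[of _ "p * q"]) auto
qed

lemma poly_eq_sum_upto: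
  fixes p :: "'a::comm_semiring_1 poly"
  assumes "degree p \<le> n"
  shows "poly p x = (\<Sum>i\<le>n. coeff p i * x ^ i)"
  unfolding poly_altdef using assms
  by (intro sum.mono_neutral_left) (auto simp: coeff_eq_0)

lemma poly_of_coeff_sequence:
  fixes f :: "nat \<Rightarrow> 'a::comm_semiring_1"
  shows "coeff (\<Sum>j\<le>n. monom (f j) j) i = (if i \<le> n then f i else 0)"
    and "poly (\<Sum>j\<le>n. monom (f j) j) x = (\<Sum>j\<le>n. f j * x ^ j)"
  by (auto simp: coeff_sum poly_sum poly_monom)

section \<open>Transcendental elements\<close>

definition transcendental_over :: "'a::comm_ring_1 set \<Rightarrow> 'a \<Rightarrow> bool" where
  "transcendental_over R v \<longleftrightarrow> (\<forall>p. coeffs_in R p \<longrightarrow> poly p v = 0 \<longrightarrow> p = 0)"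

lemma transcendental_not_mem:
  assumes "subring R" "transcendental_over R v"
  shows "v \<notin> R"
proof
  assume "v \<in> R"
  then have "coeffs_in R [:- v, 1:]"
    by (intro coeffs_in_pCons coeffs_in_const assms subringD[OF assms(1)])
  then show False
    using assms(2) by (auto simp: transcendental_over_def)
qed

text \<open>
  A relation $p$ of $q(v)$ is a relation $p \circ q$ of $v$, and composition with a nonconstant
  polynomial does not kill $p$.
\<close>

lemma transcendental_over_poly:
  fixes v :: "'a::idom"
  assumes "subring R" "transcendental_over R v" "coeffs_in R q" "degree q > 0"
  shows "transcendental_over R (poly q v)"
  unfolding transcendental_over_def
proof (intro allI impI)
  fix p assume p: "coeffs_in R p" "poly p (poly q v) = 0"
  then have "pcompose p q = 0"
    using assms(2) coeffs_in_pcompose[OF assms(1) p(1) assms(3)]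
    by (auto simp: transcendental_over_def poly_pcompose)
  then show "p = 0"
    using assms(4) by (rule pcompose_eq_0)
qed

lemma transcendental_over_inverse:
  fixes v :: "'a::field"
  assumes "subring R" "transcendental_over R v"
  shows "transcendental_over R (inverse v)"
  unfolding transcendental_over_def
proof (intro allI impI)
  fix p assume p: "coeffs_in R p" "poly p (inverse v) = 0"
  have "v \<noteq> 0"
    using transcendental_not_mem[OF assms] subringD(1)[OF assms(1)] by auto
  then have "poly (reflect_poly p) v = 0"
    using p by (simp add: poly_reflect_poly_nz)
  moreover have "coeffs_in R (reflect_poly p)"
    using p(1) subringD(1)[OF assms(1)] by (auto simp: coeffs_in_def coeff_reflect_poly)
  ultimately show "p = 0"
    using assms(2) by (auto simp: transcendental_over_def)
qed

section \<open>Independent pairs\<close>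

text \<open>
  Writing relations as square arrays of coefficients makes the notion visibly symmetric in $u$ and
  $v$.  The results on transcendental elements apply after passing to the tower $R \subseteq R[u]$;
  \<open>independent_pair_imp_transcendental\<close> and \<open>independent_pairI\<close> lead to the tower and back.
\<close>

definition independent_pair :: "'a::comm_ring_1 set \<Rightarrow> 'a \<Rightarrow> 'a \<Rightarrow> bool" where
  "independent_pair R u v \<longleftrightarrow>
     (\<forall>P n. (\<forall>i j. P i j \<in> R) \<longrightarrow> (\<Sum>i\<le>n. \<Sum>j\<le>n. P i j * u ^ i * v ^ j) = 0 \<longrightarrow>
        (\<forall>i\<le>n. \<forall>j\<le>n. P i j = 0))"

lemma independent_pair_swap:
  assumes "independent_pair R u v"
  shows "independent_pair R v u"
  unfolding independent_pair_def
proof (intro allI impI)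
  fix P n and i j :: nat
  assume P: "\<forall>i j. P i j \<in> R" "(\<Sum>i\<le>n. \<Sum>j\<le>n. P i j * v ^ i * u ^ j) = 0" "i \<le> n" "j \<le> n"
  have "(\<Sum>i\<le>n. \<Sum>j\<le>n. P j i * u ^ i * v ^ j) = (\<Sum>i\<le>n. \<Sum>j\<le>n. P i j * v ^ i * u ^ j)"
    by (subst sum.swap) (simp add: mult_ac)
  then show "P i j = 0"
    using assms[unfolded independent_pair_def, rule_format, of "\<lambda>i j. P j i" n j i] P by auto
qed

lemma independent_pair_imp_transcendental:
  assumes "subring R" "independent_pair R u v"
  shows "transcendental_over (ring_adjoin R u) v"
  unfolding transcendental_over_def
proof (intro allI impI)
  fix p assume p: "coeffs_in (ring_adjoin R u) p" "poly p v = 0"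
  \<comment> \<open>The zero coefficients of \<open>p\<close> get the zero polynomial, so that only finitely many degrees
    matter.\<close>
  have "\<exists>g. coeffs_in R g \<and> coeff p j = poly g u \<and> (coeff p j = 0 \<longrightarrow> g = 0)" for j
  proof (cases "coeff p j = 0")
    case True
    then show ?thesis
      using subringD(1)[OF assms(1)] by (intro exI[of _ 0]) (auto simp: coeffs_in_def)
  next
    case False
    then show ?thesis
      using p(1) by (auto simp: coeffs_in_def ring_adjoin_def)
  qed
  then obtain g where g: "\<And>j. coeffs_in R (g j)" "\<And>j. coeff p j = poly (g j) u"
    "\<And>j. coeff p j = 0 \<Longrightarrow> g j = 0"
    by metis
  define n where "n = degree p + (\<Sum>j\<le>degree p. degree (g j))"
  have deg_g: "degree (g j) \<le> n" for j
  proof (cases "j \<le> degree p")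
    case True
    then have "degree (g j) \<le> (\<Sum>j\<le>degree p. degree (g j))"
      by (intro member_le_sum) auto
    then show ?thesis by (simp add: n_def)
  qed (simp add: coeff_eq_0 g(3))
  have "(\<Sum>i\<le>n. \<Sum>j\<le>n. coeff (g j) i * u ^ i * v ^ j) = (\<Sum>j\<le>n. poly (g j) u * v ^ j)"
    by (subst sum.swap) (simp add: poly_eq_sum_upto[OF deg_g] sum_distrib_right)
  also have "\<dots> = poly p v"
    by (simp add: poly_eq_sum_upto[of p n] n_def g(2))
  finally have "\<forall>i\<le>n. \<forall>j\<le>n. coeff (g j) i = 0"
    using assms(2)[unfolded independent_pair_def, rule_format, of "\<lambda>i j. coeff (g j) i" n] g(1) p(2)
    by (auto simp: coeffs_in_def)
  moreover have "coeff (g j) i = 0" if "i > n" for i j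
    using deg_g[of j] that by (auto intro: coeff_eq_0)
  moreover have "coeff p j = 0" if "j > n" for j
    using that by (auto intro: coeff_eq_0 simp: n_def)
  ultimately have "g j = 0" for j
    using g(3) by (metis poly_eqI coeff_0 not_le)
  then show "p = 0"
    using g(2) by (intro poly_eqI) simp
qed

lemma independent_pairI:
  assumes "subring R" "transcendental_over R u" "transcendental_over (ring_adjoin R u) v"
  shows "independent_pair R u v"
  unfolding independent_pair_def
proof (intro allI impI)
  fix P n and i j :: nat
  assume P: "\<forall>i j. P i j \<in> R" "(\<Sum>i\<le>n. \<Sum>j\<le>n. P i j * u ^ i * v ^ j) = 0" "i \<le> n" "j \<le> n"
  define f where "f j = (\<Sum>i\<le>n. monom (P i j) i)" for j
  define p where "p = (\<Sum>j\<le>n. monom (poly (f j) u) j)"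
  have f: "coeffs_in R (f j)" for j
    using P(1) subringD(1)[OF assms(1)] by (auto simp: coeffs_in_def f_def poly_of_coeff_sequence)
  then have "poly (f j) u \<in> ring_adjoin R u" for j
    by (auto simp: ring_adjoin_def)
  then have "coeffs_in (ring_adjoin R u) p"
    using subringD(1)[OF subring_ring_adjoin[OF assms(1)]]
    by (auto simp: coeffs_in_def p_def poly_of_coeff_sequence)
  moreover have "poly p v = (\<Sum>i\<le>n. \<Sum>j\<le>n. P i j * u ^ i * v ^ j)"
    by (subst sum.swap) (simp add: p_def f_def poly_of_coeff_sequence(2) sum_distrib_right)
  ultimately have "p = 0"
    using assms(3) P(2) by (auto simp: transcendental_over_def)
  moreover have "coeff p j = poly (f j) u"
    using \<open>j \<le> n\<close> by (simp add: p_def poly_of_coeff_sequence(1))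
  ultimately have "poly (f j) u = 0"
    by simp
  then have "f j = 0"
    using assms(2) f by (auto simp: transcendental_over_def)
  moreover have "coeff (f j) i = P i j"
    using \<open>i \<le> n\<close> by (simp add: f_def poly_of_coeff_sequence(1))
  ultimately show "P i j = 0"
    by simp
qed

lemma independent_pair_imp_transcendental_base:
  assumes "subring R" "independent_pair R u v"
  shows "transcendental_over R u"
  using independent_pair_imp_transcendental[OF assms(1) independent_pair_swap[OF assms(2)]]
    ring_adjoin_mem(1)[OF assms(1)]
  by (auto simp: transcendental_over_def coeffs_in_def)

lemma independent_pair_poly:
  fixes v :: "'a::idom"
  assumes "subring R" "independent_pair R u v" "coeffs_in (ring_adjoin R u) q" "degree q > 0"
  shows "independent_pair R u (poly q v)"
  using independent_pairI[OF assms(1) independent_pair_imp_transcendental_base[OF assms(1,2)]]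
    transcendental_over_poly[OF subring_ring_adjoin[OF assms(1)]
      independent_pair_imp_transcendental[OF assms(1,2)] assms(3,4)] .

lemma independent_pair_inverse:
  fixes v :: "'a::field"
  assumes "subring R" "independent_pair R u v"
  shows "independent_pair R u (inverse v)"
  using independent_pairI[OF assms(1) independent_pair_imp_transcendental_base[OF assms(1,2)]]
    transcendental_over_inverse[OF subring_ring_adjoin[OF assms(1)]
      independent_pair_imp_transcendental[OF assms(1,2)]] .

lemma independent_pair_mult:
  fixes v :: "'a::idom"
  assumes "subring R" "independent_pair R u v" "h \<in> ring_adjoin R u" "h \<noteq> 0"
  shows "independent_pair R u (h * v)"
proof -
  have "coeffs_in (ring_adjoin R u) [:0, h:]"
    by (intro coeffs_in_pCons coeffs_in_const assms subring_ring_adjoin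
        subringD[OF subring_ring_adjoin[OF assms(1)]])
  from independent_pair_poly[OF assms(1,2) this] show ?thesis
    using assms(4) by (simp add: mult.commute)
qed

text \<open>
  Division needs only a denominator in $R[u]$, not its inverse: $v/h$ is the inverse of $h$ times
  the inverse of $v$.
\<close>

lemma independent_pair_divide:
  fixes v :: "'a::field"
  assumes "subring R" "independent_pair R u v" "h \<in> ring_adjoin R u" "h \<noteq> 0"
  shows "independent_pair R u (v / h)"
proof -
  have "independent_pair R u (inverse (h * inverse v))"
    using independent_pair_inverse independent_pair_mult assms by metis
  then show ?thesis
    by (simp add: field_simps)
qed

lemma independent_pair_neq:
  assumes "subring R" "independent_pair R u v"
  shows "u \<noteq> v"
  using transcendental_not_mem[OF subring_ring_adjoin independent_pair_imp_transcendental]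
    ring_adjoin_mem(2) assms by metis

text \<open>
  A monomial supported on $\{s,t\}$ is determined by its two exponents, so a polynomial in $s$ and
  $t$ is a square array of coefficients.
\<close>

lemma independent_pair_imp_algebraically_independent:
  fixes K :: "'a::field set"
  assumes "subring K" "independent_pair K s t"
  shows "algebraically_independent K {s, t}"
  unfolding algebraically_independent_def
proof (intro allI impI)
  fix p :: "('a \<Rightarrow>\<^sub>0 nat) \<Rightarrow>\<^sub>0 'a"
  assume p: "\<forall>m. Poly_Mapping.lookup p m \<in> K"
    "\<forall>m\<in>Poly_Mapping.keys p. Poly_Mapping.keys m \<subseteq> {s, t}" "eval_at_indices p = 0"
  have st: "s \<noteq> t"
    using independent_pair_neq[OF assms] .
  define mon where "mon i j = Poly_Mapping.single s i + Poly_Mapping.single t j" for i j :: nat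
  have lookup_mon: "Poly_Mapping.lookup (mon i j) s = i" "Poly_Mapping.lookup (mon i j) t = j" for i j
    using st by (auto simp: mon_def lookup_add lookup_single when_def)
  have mon_lookup: "mon (Poly_Mapping.lookup m s) (Poly_Mapping.lookup m t) = m"
    if "Poly_Mapping.keys m \<subseteq> {s, t}" for m
  proof (rule poly_mapping_eqI)
    fix x
    have "Poly_Mapping.lookup m x = 0" if "x \<notin> {s, t}"
      using that \<open>Poly_Mapping.keys m \<subseteq> {s, t}\<close> by (meson in_keys_iff subsetD)
    then show "Poly_Mapping.lookup (mon (Poly_Mapping.lookup m s) (Poly_Mapping.lookup m t)) x =
      Poly_Mapping.lookup m x"
      using st by (auto simp: mon_def lookup_add lookup_single when_def)
  qed
  have inj: "inj_on (\<lambda>(i, j). mon i j) A" for A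
    by (auto simp: inj_on_def) (metis lookup_mon)+
  \<comment> \<open>A crude common bound for all exponents that occur.\<close>
  define n where
    "n = (\<Sum>m\<in>Poly_Mapping.keys p. Poly_Mapping.lookup m s + Poly_Mapping.lookup m t)"
  have n: "Poly_Mapping.lookup m s \<le> n" "Poly_Mapping.lookup m t \<le> n"
    if "m \<in> Poly_Mapping.keys p" for m
    using member_le_sum[of m "Poly_Mapping.keys p"
        "\<lambda>m. Poly_Mapping.lookup m s + Poly_Mapping.lookup m t"] that
    by (auto simp: n_def)
  have keys: "Poly_Mapping.keys p \<subseteq> (\<lambda>(i, j). mon i j) ` ({..n} \<times> {..n})"
  proof
    fix m assume m: "m \<in> Poly_Mapping.keys p"
    then have "m = mon (Poly_Mapping.lookup m s) (Poly_Mapping.lookup m t)"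
      using p(2) mon_lookup by auto
    then show "m \<in> (\<lambda>(i, j). mon i j) ` ({..n} \<times> {..n})"
      using n[OF m] by (intro image_eqI[of _ _ "(Poly_Mapping.lookup m s, Poly_Mapping.lookup m t)"]) auto
  qed
  let ?term = "\<lambda>m. Poly_Mapping.lookup p m * s ^ Poly_Mapping.lookup m s * t ^ Poly_Mapping.lookup m t"
  have "(\<Prod>x\<in>Poly_Mapping.keys m. x ^ Poly_Mapping.lookup m x) =
      s ^ Poly_Mapping.lookup m s * t ^ Poly_Mapping.lookup m t"
    if "m \<in> Poly_Mapping.keys p" for m
  proof -
    have "(\<Prod>x\<in>Poly_Mapping.keys m. x ^ Poly_Mapping.lookup m x) =
        (\<Prod>x\<in>{s, t}. x ^ Poly_Mapping.lookup m x)"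
      using p(2) that by (intro prod.mono_neutral_left) (auto simp: in_keys_iff)
    then show ?thesis
      using st by simp
  qed
  then have "eval_at_indices p = (\<Sum>m\<in>Poly_Mapping.keys p. ?term m)"
    by (simp add: eval_at_indices_def mult.assoc)
  also have "\<dots> = (\<Sum>m\<in>(\<lambda>(i, j). mon i j) ` ({..n} \<times> {..n}). ?term m)"
    using keys by (intro sum.mono_neutral_left) (auto simp: in_keys_iff)
  also have "\<dots> = (\<Sum>(i, j)\<in>{..n} \<times> {..n}. Poly_Mapping.lookup p (mon i j) * s ^ i * t ^ j)"
    by (subst sum.reindex[OF inj]) (auto simp: lookup_mon intro!: sum.cong)
  also have "\<dots> = (\<Sum>i\<le>n. \<Sum>j\<le>n. Poly_Mapping.lookup p (mon i j) * s ^ i * t ^ j)"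
    by (simp add: sum.cartesian_product)
  finally have zero: "Poly_Mapping.lookup p (mon i j) = 0" if "i \<le> n" "j \<le> n" for i j
    using assms(2)[unfolded independent_pair_def, rule_format,
        of "\<lambda>i j. Poly_Mapping.lookup p (mon i j)" n i j] p(1,3) that by auto
  have "Poly_Mapping.keys p = {}"
  proof (rule equals0I)
    fix m assume m: "m \<in> Poly_Mapping.keys p"
    then obtain i j where "i \<le> n" "j \<le> n" "m = mon i j"
      using keys by auto
    then show False
      using m zero by (auto simp: in_keys_iff)
  qed
  then show "p = 0" by simp
qed

section \<open>Fixed fields of involutions\<close>

lemma subfield_imp_subring: "subfield F \<Longrightarrow> subring F"
  by (auto simp: subfield_def subring_def)

lemma subfield_divide:
  assumes "subfield F" "x \<in> F" "y \<in> F"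
  shows "x / y \<in> F"
  using assms by (auto simp: subfield_def divide_inverse)

lemma subfield_field_adjoin: "subfield (field_adjoin K S)"
  unfolding field_adjoin_def by (rule hull_in) (auto simp: subfield_def)

lemma field_adjoin_superset: "K \<union> S \<subseteq> field_adjoin K S"
  unfolding field_adjoin_def by (rule hull_subset)

lemma field_adjoin_minimal: "K \<union> S \<subseteq> F \<Longrightarrow> subfield F \<Longrightarrow> field_adjoin K S \<subseteq> F"
  unfolding field_adjoin_def by (rule hull_minimal)

locale field_automorphism =
  fixes \<sigma> :: "'a::field \<Rightarrow> 'a" and K :: "'a set"
  assumes automorphism: "field_automorphism_over K \<sigma>"
begin

lemma hom_add: "\<sigma> (f + g) = \<sigma> f + \<sigma> g"
  and hom_mult: "\<sigma> (f * g) = \<sigma> f * \<sigma> g"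
  and hom_const: "c \<in> K \<Longrightarrow> \<sigma> c = c"
  and inj: "inj \<sigma>"
  using automorphism by (auto simp: field_automorphism_over_def bij_def)

lemma hom_0: "\<sigma> 0 = 0"
  using hom_add[of 0 0] by (metis add.right_neutral add_left_cancel)

lemma hom_eq_0_iff: "\<sigma> f = 0 \<longleftrightarrow> f = 0"
  using inj hom_0 by (metis injD)

lemma hom_1: "\<sigma> 1 = 1"
  using hom_mult[of 1 1] hom_eq_0_iff[of 1] by simp

lemma hom_minus: "\<sigma> (- f) = - \<sigma> f"
  using hom_add[of f "- f"] hom_0 by (metis add.right_inverse minus_unique)

lemma hom_diff: "\<sigma> (f - g) = \<sigma> f - \<sigma> g"
  using hom_add[of f "- g"] by (simp add: hom_minus)

lemma hom_inverse: "\<sigma> (inverse f) = inverse (\<sigma> f)"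
proof (cases "f = 0")
  case False
  then have "\<sigma> f * \<sigma> (inverse f) = 1"
    by (metis hom_mult hom_1 right_inverse)
  then show ?thesis
    by (rule inverse_unique[symmetric])
qed (simp add: hom_0)

lemma hom_divide: "\<sigma> (f / g) = \<sigma> f / \<sigma> g"
  by (simp add: divide_inverse hom_mult hom_inverse)

lemma hom_power: "\<sigma> (f ^ n) = \<sigma> f ^ n"
  by (induction n) (auto simp: hom_mult hom_1)

lemma hom_numeral: "\<sigma> (numeral n) = numeral n"
proof -
  have "\<sigma> (of_nat m) = of_nat m" for m
    by (induction m) (auto simp: hom_0 hom_1 hom_add)
  from this[of "numeral n"] show ?thesis by simp
qed

lemma subfield_fixed: "subfield {f. \<sigma> f = f}"
  by (auto simp: subfield_def hom_0 hom_1 hom_add hom_mult hom_minus hom_inverse)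

text \<open>
  The elements $p + qz$ with $p, q \in F$ form a field: $z$ is a root of a monic quadratic
  polynomial over $F$, and $p + q\,\sigma(z) = \sigma(p + qz)$ serves to invert $p + qz$, because the
  product of the two lies in $F$.  This field is everything, and since $z \neq \sigma(z)$, a fixed
  $p + qz$ must have $q = 0$.
\<close>

lemma fixed_field_of_involution:
  assumes F: "subfield F" "F \<subseteq> {f. \<sigma> f = f}"
    and z: "z + \<sigma> z \<in> F" "z * \<sigma> z \<in> F" "\<sigma> z \<noteq> z"
    and generates: "\<And>E. subfield E \<Longrightarrow> F \<subseteq> E \<Longrightarrow> z \<in> E \<Longrightarrow> E = UNIV"
  shows "{f. \<sigma> f = f} = F"
proof -
  note R = subringD[OF subfield_imp_subring[OF F(1)]]
  define E where "E = {p + q * z | p q. p \<in> F \<and> q \<in> F}"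
  have E_I: "p + q * z \<in> E" if "p \<in> F" "q \<in> F" for p q
    using that by (auto simp: E_def)
  define T N where "T = z + \<sigma> z" and "N = z * \<sigma> z"
  have TN: "T \<in> F" "N \<in> F"
    using z by (auto simp: T_def N_def)
  have sigma_z: "\<sigma> z = T - z"
    by (simp add: T_def)
  have z_square: "z * z = T * z - N"
    by (simp add: T_def N_def algebra_simps)
  have F_E: "F \<subseteq> E"
    using E_I[OF _ R(1)] by auto
  have z_E: "z \<in> E"
    using E_I[OF R(1,2)] by simp
  have "subfield E"
    unfolding subfield_def
  proof (intro conjI ballI)
    show "0 \<in> E" "1 \<in> E"
      using F_E R by auto
  next
    fix x y assume "x \<in> E" "y \<in> E"
    then obtain p q r s where xy: "x = p + q * z" "y = r + s * z"
      and pqrs: "p \<in> F" "q \<in> F" "r \<in> F" "s \<in> F"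
      by (auto simp: E_def)
    have "x + y = (p + r) + (q + s) * z"
      by (simp add: xy algebra_simps)
    also have "\<dots> \<in> E"
      using pqrs by (intro E_I R)
    finally show "x + y \<in> E" .
    have "x * y = p * r + (p * s + q * r) * z + q * s * (z * z)"
      by (simp add: xy algebra_simps)
    also have "\<dots> = (p * r - q * s * N) + (p * s + q * r + q * s * T) * z"
      by (simp add: z_square algebra_simps)
    also have "\<dots> \<in> E"
      using pqrs TN by (intro E_I R)
    finally show "x * y \<in> E" .
  next
    fix x assume "x \<in> E"
    then obtain p q where x: "x = p + q * z" and pq: "p \<in> F" "q \<in> F"
      by (auto simp: E_def)
    have "- x = - p + (- q) * z"
      by (simp add: x)
    also have "\<dots> \<in> E"
      using pq by (intro E_I R)
    finally show "- x \<in> E" .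
    define y M where "y = (p + q * T) - q * z" and "M = p * p + p * q * T + q * q * N"
    have "\<sigma> p = p" "\<sigma> q = q"
      using F(2) pq by auto
    then have y: "y = \<sigma> x"
      by (simp add: x y_def hom_add hom_mult sigma_z algebra_simps)
    have "x * y = M"
      by (simp add: x y_def M_def N_def T_def algebra_simps)
    have "M \<in> F"
      unfolding M_def using pq TN by (intro R)
    then have "inverse M \<in> F"
      using F(1) by (auto simp: subfield_def)
    show "inverse x \<in> E"
    proof (cases "x = 0")
      case True
      then show ?thesis using F_E R by auto
    next
      case False
      then have "y \<noteq> 0"
        using hom_eq_0_iff y by auto
      then have "inverse x = y * inverse M"
        using False \<open>x * y = M\<close> by (auto simp: field_simps)
      also have "\<dots> = (p + q * T) * inverse M + (- q * inverse M) * z"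
        by (simp add: y_def algebra_simps)
      also have "\<dots> \<in> E"
        using pq TN \<open>inverse M \<in> F\<close> by (intro E_I R)
      finally show ?thesis .
    qed
  qed
  then have "E = UNIV"
    using F_E z_E by (rule generates)
  have "f \<in> F" if "\<sigma> f = f" for f
  proof -
    obtain p q where f: "f = p + q * z" "p \<in> F" "q \<in> F"
      using UNIV_I[of f] unfolding \<open>E = UNIV\<close>[symmetric] E_def by blast
    then have "\<sigma> p = p" "\<sigma> q = q"
      using F(2) by auto
    then have "p + q * \<sigma> z = p + q * z"
      using that by (simp add: f(1) hom_add hom_mult)
    then have "q = 0"
      using z(3) by simp
    then show ?thesis
      using f by simp
  qed
  then show ?thesis
    using F(2) by auto
qed

end

section \<open>The field $k(x_1,x_2)$\<close>

lemma constants_eq: "constants = range (\<lambda>c. to_fract [:[:c:]:])"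
  by (simp add: constants_def to_fract_def)

lemma x1_eq: "x1 = to_fract [:[:0, 1:]:]" and x2_eq: "x2 = to_fract [:0, 1:]"
  by (simp_all add: x1_def x2_def to_fract_def)

lemma to_fract_power: "to_fract (p ^ n) = to_fract p ^ n"
  by (induction n) auto

lemma to_fract_inverse_constant: "inverse (to_fract [:[:c:]:]) = to_fract [:[:inverse c:]:]"
  for c :: "'k::field"
proof (cases "c = 0")
  case False
  then have "to_fract [:[:c:]:] * to_fract [:[:inverse c:]:] = 1"
    by (simp flip: to_fract_mult one_pCons)
  then show ?thesis
    by (rule inverse_unique)
qed simp

lemma subfield_constants: "subfield (constants :: 'k::field poly poly fract set)"
  unfolding subfield_def constants_eq
proof (intro conjI ballI)
  show "0 \<in> range (\<lambda>c::'k. to_fract [:[:c:]:])"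
    by (intro range_eqI[of _ _ 0]) simp
  show "1 \<in> range (\<lambda>c::'k. to_fract [:[:c:]:])"
    by (intro range_eqI[of _ _ 1]) (simp flip: one_pCons)
next
  fix x y :: "'k poly poly fract"
  assume "x \<in> range (\<lambda>c. to_fract [:[:c:]:])" "y \<in> range (\<lambda>c. to_fract [:[:c:]:])"
  then obtain a b where xy: "x = to_fract [:[:a:]:]" "y = to_fract [:[:b:]:]"
    by auto
  show "x + y \<in> range (\<lambda>c. to_fract [:[:c:]:])"
    by (intro range_eqI[of _ _ "a + b"]) (simp add: xy flip: to_fract_add)
  show "x * y \<in> range (\<lambda>c. to_fract [:[:c:]:])"
    by (intro range_eqI[of _ _ "a * b"]) (simp add: xy flip: to_fract_mult)
next
  fix x :: "'k poly poly fract"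
  assume "x \<in> range (\<lambda>c. to_fract [:[:c:]:])"
  then obtain a where x: "x = to_fract [:[:a:]:]"
    by auto
  show "- x \<in> range (\<lambda>c. to_fract [:[:c:]:])"
    by (intro range_eqI[of _ _ "- a"]) (simp add: x flip: to_fract_uminus)
  show "inverse x \<in> range (\<lambda>c. to_fract [:[:c:]:])"
    by (simp add: x to_fract_inverse_constant)
qed

lemma independent_pair_x1_x2: "independent_pair constants x1 (x2 :: 'k::field poly poly fract)"
  unfolding independent_pair_def
proof (intro allI impI)
  fix P :: "nat \<Rightarrow> nat \<Rightarrow> 'k poly poly fract" and n and i j :: nat
  assume P: "\<forall>i j. P i j \<in> constants" "(\<Sum>i\<le>n. \<Sum>j\<le>n. P i j * x1 ^ i * x2 ^ j) = 0"
    and ij: "i \<le> n" "j \<le> n"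
  have "\<forall>i j. \<exists>c. P i j = to_fract [:[:c:]:]"
    using P(1) by (auto simp: constants_eq)
  then obtain Q where Q: "\<And>i j. P i j = to_fract [:[:Q i j:]:]"
    by metis
  have "P i j * x1 ^ i * x2 ^ j = to_fract (monom (monom (Q i j) i) j)" for i j
  proof -
    have "[:[:Q i j:]:] * [:[:0, 1:]:] ^ i * [:0, 1:] ^ j = monom (monom (Q i j) i) j"
      by (simp add: monom_altdef poly_const_pow)
    then show ?thesis
      by (simp add: Q x1_eq x2_eq flip: to_fract_mult to_fract_power)
  qed
  then have "to_fract (\<Sum>i\<le>n. \<Sum>j\<le>n. monom (monom (Q i j) i) j) = 0"
    using P(2) by simp
  then have "(\<Sum>i\<le>n. \<Sum>j\<le>n. monom (monom (Q i j) i) j) = 0"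
    by (simp only: to_fract_eq_0_iff)
  then have "coeff (coeff (\<Sum>i\<le>n. \<Sum>j\<le>n. monom (monom (Q i j) i) j) j) i = 0"
    by simp
  then have "Q i j = 0"
    using ij by (simp add: coeff_sum if_distrib[of "\<lambda>p. coeff p i"] cong: if_cong)
  then show "P i j = 0"
    by (simp add: Q)
qed

lemma subfield_eq_UNIV:
  fixes E :: "'k::field poly poly fract set"
  assumes "subfield E" "constants \<subseteq> E" "x1 \<in> E" "x2 \<in> E"
  shows "E = UNIV"
proof -
  note R = subringD[OF subfield_imp_subring[OF assms(1)]]
  have inner: "to_fract [:p:] \<in> E" for p :: "'k poly"
  proof (induction p)
    case (pCons a p)
    have "to_fract [:pCons a p:] = to_fract [:[:a:]:] + x1 * to_fract [:p:]"
      by (simp add: x1_eq flip: to_fract_add to_fract_mult)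
    also have "\<dots> \<in> E"
      using assms pCons by (intro R) (auto simp: constants_eq)
    finally show ?case .
  qed (simp add: R)
  have outer: "to_fract p \<in> E" for p :: "'k poly poly"
  proof (induction p)
    case (pCons a p)
    have "to_fract (pCons a p) = to_fract [:a:] + x2 * to_fract p"
      by (simp add: x2_eq flip: to_fract_add to_fract_mult)
    also have "\<dots> \<in> E"
      using assms pCons inner by (intro R) auto
    finally show ?case .
  qed (simp add: R)
  have "f \<in> E" for f
    by (cases f) (auto simp: Fract_conv_to_fract intro: subfield_divide assms outer)
  then show ?thesis by auto
qed


lemma x1_nonzero: "x1 \<noteq> 0" and x2_nonzero: "x2 \<noteq> 0"
  by (simp_all add: x1_eq x2_eq)

definition coord_b :: "'k::field poly poly fract" where
  "coord_b = x1 / x2 ^ 2"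

definition coord_c :: "'k::field poly poly fract" where
  "coord_c = x2 / x1"

lemma coords_nonzero: "coord_b \<noteq> 0" "coord_c \<noteq> 0"
  by (simp_all add: coord_b_def coord_c_def x1_nonzero x2_nonzero)

text \<open>
  The chain of pairs is $(x_2,x_1) \mapsto (x_2,b) \mapsto (b,x_2) \mapsto (b,bx_2) \mapsto (b,c)$,
  where $c = 1/(bx_2)$.
\<close>

lemma independent_pair_coords:
  "independent_pair constants coord_b (coord_c :: 'k::field poly poly fract)"
proof -
  have R: "subring (constants :: 'k poly poly fract set)"
    by (rule subfield_imp_subring[OF subfield_constants])
  have "independent_pair constants x2 (coord_b :: 'k poly poly fract)"
    unfolding coord_b_def
    by (rule independent_pair_divide[OF R independent_pair_swap[OF independent_pair_x1_x2]])
      (auto simp: x2_nonzero intro: subringD(7)[OF subring_ring_adjoin[OF R]] ring_adjoin_mem(2)[OF R])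
  then have "independent_pair constants coord_b (coord_b * x2 :: 'k poly poly fract)"
    using independent_pair_mult[OF R independent_pair_swap ring_adjoin_mem(2)[OF R]] coords_nonzero(1)
    by blast
  then have "independent_pair constants coord_b (inverse (coord_b * x2) :: 'k poly poly fract)"
    by (rule independent_pair_inverse[OF R])
  moreover have "inverse (coord_b * x2) = (coord_c :: 'k poly poly fract)"
    by (simp add: coord_b_def coord_c_def x1_nonzero x2_nonzero field_simps power2_eq_square)
  ultimately show ?thesis
    by simp
qed

lemma subfield_eq_UNIV_coords:
  fixes E :: "'k::field poly poly fract set"
  assumes "subfield E" "constants \<subseteq> E" "coord_b \<in> E" "coord_c \<in> E"
  shows "E = UNIV"
proof (rule subfield_eq_UNIV[OF assms(1,2)])
  note R = subringD[OF subfield_imp_subring[OF assms(1)]]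
  have "x1 = (1 :: 'k poly poly fract) / (coord_b * coord_c ^ 2)"
    "x2 = (1 :: 'k poly poly fract) / (coord_b * coord_c)"
    by (simp_all add: coord_b_def coord_c_def x1_nonzero x2_nonzero field_simps power2_eq_square)
  moreover have "1 / (coord_b * coord_c ^ 2) \<in> E" "1 / (coord_b * coord_c) \<in> E"
    by (intro subfield_divide[OF assms(1)] R assms)+
  ultimately show "x1 \<in> E" "x2 \<in> E"
    by simp_all
qed

text \<open>
  The sum and product of $b$ and $w$ arise from $b$ and $w$ as $b + w$ and then, over $R[b+w]$, as
  the quadratic polynomial $(b + w)b - b^2$ in $b$; in between, the pair is swapped.
\<close>

lemma independent_pair_sum_product:
  fixes b w :: "'a::idom"
  assumes R: "subring R" and "independent_pair R b w"
  shows "independent_pair R (b + w) (b * w)"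
proof -
  have "coeffs_in (ring_adjoin R b) [:b, 1:]"
    by (intro coeffs_in_pCons coeffs_in_const subring_ring_adjoin ring_adjoin_mem
        subringD[OF subring_ring_adjoin[OF R]] R)
  from independent_pair_poly[OF R assms(2) this]
  have "independent_pair R (b + w) b"
    by (simp add: add.commute independent_pair_swap)
  moreover have "coeffs_in (ring_adjoin R (b + w)) [:0, b + w, - 1:]"
    by (intro coeffs_in_pCons coeffs_in_const subring_ring_adjoin ring_adjoin_mem(2)
        subringD(1,2,3)[OF subring_ring_adjoin[OF R]] R)
  ultimately have "independent_pair R (b + w) (poly [:0, b + w, - 1:] b)"
    by (rule independent_pair_poly[OF R]) simp
  moreover have "poly [:0, b + w, - 1:] b = b * w"
    by (simp add: algebra_simps)
  ultimately show ?thesis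
    by simp
qed

lemma rational_overI:
  assumes "subring K" "independent_pair K s t" "L = field_adjoin K {s, t}"
  shows "rational_over K L"
  unfolding rational_over_def
  using independent_pair_imp_algebraically_independent[OF assms(1,2)] assms(3) by blast

section \<open>Rationality of the fixed field\<close>

theorem theorem1p1:
  fixes \<sigma> :: "'k::field poly poly fract \<Rightarrow> 'k poly poly fract"
  assumes "field_automorphism_over constants \<sigma>"
    and "\<sigma> x1 = - x1 * (3 * x1 - 9 * x2 - x2 ^ 2) ^ 3 /
           (27 * x1 + 2 * x1 ^ 2 + 9 * x1 * x2 + 2 * x1 * x2 ^ 2 - x2 ^ 3) ^ 2"
    and "\<sigma> x2 = - (3 * x1 + x2 ^ 2) * (3 * x1 - 9 * x2 - x2 ^ 2) /
           (27 * x1 + 2 * x1 ^ 2 + 9 * x1 * x2 + 2 * x1 * x2 ^ 2 - x2 ^ 3)"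
  shows "rational_over constants {f. \<sigma> f = f}"
proof -
  interpret field_automorphism \<sigma> constants
    by unfold_locales (fact assms(1))
  note hom = hom_add hom_diff hom_minus hom_mult hom_divide hom_power hom_numeral hom_1
  let ?K = "constants :: 'k poly poly fract set"
  have K: "subring ?K"
    by (rule subfield_imp_subring[OF subfield_constants])
  define x y :: "'k poly poly fract" where "x = x1" and "y = x2"
  define b c :: "'k poly poly fract" where "b = coord_b" and "c = coord_c"
  define N M D where "N = 3 * x - 9 * y - y ^ 2" and "M = 3 * x + y ^ 2"
    and "D = 27 * x + 2 * x ^ 2 + 9 * x * y + 2 * x * y ^ 2 - y ^ 3"
  have nz: "x \<noteq> 0" "y \<noteq> 0" "b \<noteq> 0" "c \<noteq> 0"
    by (simp_all add: x_def y_def b_def c_def x1_nonzero x2_nonzero coords_nonzero)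
  have b: "b = x / y ^ 2" and c: "c = y / x"
    by (simp_all add: x_def y_def b_def c_def coord_b_def coord_c_def)
  have sx: "\<sigma> x = - x * N ^ 3 / D ^ 2" and sy: "\<sigma> y = - M * N / D"
    using assms(2,3) by (simp_all add: x_def y_def N_def M_def D_def)
  \<comment> \<open>Were one of these zero, then by the convention for division by zero so would be the image of
    \<open>x\<close> or \<open>y\<close> under the injective map \<open>\<sigma>\<close>.\<close>
  have nz': "N \<noteq> 0" "D \<noteq> 0" "M \<noteq> 0"
    using hom_eq_0_iff[of x] hom_eq_0_iff[of y] nz sx sy by auto
  have sb: "\<sigma> b = - x * N / M ^ 2"
    using nz nz' by (simp add: b hom sx sy field_simps power2_eq_square power3_eq_cube)
  have sc: "\<sigma> c = M * D / (x * N ^ 2)"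
    using nz nz' by (simp add: c hom sx sy field_simps power2_eq_square power3_eq_cube)
  have bc: "independent_pair ?K b c"
    by (simp add: b_def c_def independent_pair_coords)
  note Rb = subringD[OF subring_ring_adjoin[OF K, of b]]
    subring_numeral[OF subring_ring_adjoin[OF K, of b]] ring_adjoin_mem(2)[OF K, of b]
  show ?thesis
  proof (cases "(3 :: 'k poly poly fract) = 0")
    case False
    define w where "w = \<sigma> b"
    have b1: "3 * b + 1 = M / y ^ 2"
      using nz by (simp add: b M_def field_simps)
    then have b1_nz: "3 * b + 1 \<noteq> 0"
      using nz nz' by simp
    have "(9 :: 'k poly poly fract) = 3 * 3"
      by simp
    then have nine: "(9 :: 'k poly poly fract) \<noteq> 0"
      using False by (metis mult_eq_0_iff)
    \<comment> \<open>This relation is linear in \<open>c\<close>, so it both expresses \<open>c\<close> by \<open>b\<close> and \<open>w\<close> and carries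
      independence over from \<open>b\<close>, \<open>c\<close> to \<open>b\<close>, \<open>w\<close>.\<close>
    have w: "b - 3 * b ^ 2 + 9 * b ^ 2 * c = w * (3 * b + 1) ^ 2"
    proof -
      have "b - 3 * b ^ 2 + 9 * b ^ 2 * c = - x * N / y ^ 4"
        using nz by (simp add: b c N_def field_simps power2_eq_square power4_eq_xxxx)
      also have "\<dots> = w * (3 * b + 1) ^ 2"
        unfolding b1 using nz nz' by (simp add: w_def sb field_simps power2_eq_square power4_eq_xxxx)
      finally show ?thesis .
    qed
    have sw: "\<sigma> w = b"
    proof -
      have sM: "\<sigma> M = (M ^ 2 - 3 * x * N) * N ^ 2 / D ^ 2"
      proof -
        have "\<sigma> M = 3 * (- x * N ^ 3 / D ^ 2) + (- M * N / D) ^ 2"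
          by (subst M_def) (simp add: hom sx sy)
        also have "\<dots> = (M ^ 2 - 3 * x * N) * N ^ 2 / D ^ 2"
          using nz' by (simp add: field_simps power2_eq_square power3_eq_cube)
        finally show ?thesis .
      qed
      have sN: "\<sigma> N = (9 * M * D - M ^ 2 * N - 3 * x * N ^ 2) * N / D ^ 2"
      proof -
        have "\<sigma> N = 3 * (- x * N ^ 3 / D ^ 2) - 9 * (- M * N / D) - (- M * N / D) ^ 2"
          by (subst N_def) (simp add: hom sx sy)
        also have "\<dots> = (9 * M * D - M ^ 2 * N - 3 * x * N ^ 2) * N / D ^ 2"
          using nz' by (simp add: field_simps power2_eq_square power3_eq_cube)
        finally show ?thesis .
      qed
      define A B where "A = M ^ 2 - 3 * x * N" and "B = 9 * M * D - M ^ 2 * N - 3 * x * N ^ 2"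
      have "\<sigma> M \<noteq> 0"
        using hom_eq_0_iff nz' by simp
      then have "A \<noteq> 0"
        by (auto simp: sM A_def)
      \<comment> \<open>The polynomial identity behind \<open>\<sigma>\<close> being an involution: \<open>A\<close> is
        \<open>y * (27 * x + 9 * x * y + y ^ 3)\<close>.\<close>
      have AB: "y ^ 2 * B = A ^ 2"
        unfolding A_def B_def M_def N_def D_def by algebra
      have "\<sigma> w = - (- x * N ^ 3 / D ^ 2) * (B * N / D ^ 2) / (A * N ^ 2 / D ^ 2) ^ 2"
        by (simp add: w_def sb hom sx sM sN A_def B_def)
      also have "\<dots> = x * B / A ^ 2"
        using nz' \<open>A \<noteq> 0\<close>
        by (simp add: field_simps power2_eq_square power3_eq_cube)
      also have "\<dots> = b"
        using nz \<open>A \<noteq> 0\<close> AB by (simp add: b field_simps)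
      finally show ?thesis .
    qed
    have bw: "independent_pair ?K b w"
    proof -
      have "coeffs_in (ring_adjoin ?K b) [:b - 3 * b ^ 2, 9 * b ^ 2:]"
        by (intro coeffs_in_pCons coeffs_in_const subring_ring_adjoin K Rb)
      then have "independent_pair ?K b (poly [:b - 3 * b ^ 2, 9 * b ^ 2:] c)"
        by (rule independent_pair_poly[OF K bc]) (use nz nine in simp)
      moreover have "poly [:b - 3 * b ^ 2, 9 * b ^ 2:] c = b - 3 * b ^ 2 + 9 * b ^ 2 * c"
        by simp
      ultimately have "independent_pair ?K b (w * (3 * b + 1) ^ 2)"
        by (simp only: w)
      moreover have "(3 * b + 1) ^ 2 \<in> ring_adjoin ?K b"
        by (intro Rb)
      ultimately have "independent_pair ?K b (w * (3 * b + 1) ^ 2 / (3 * b + 1) ^ 2)"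
        by (rule independent_pair_divide[OF K]) (use b1_nz in simp)
      then show ?thesis
        using b1_nz by simp
    qed
    define F where "F = field_adjoin ?K {b + w, b * w}"
    have F: "subfield F" "?K \<subseteq> F" "b + w \<in> F" "b * w \<in> F"
      unfolding F_def using subfield_field_adjoin field_adjoin_superset by blast+
    have "{f. \<sigma> f = f} = F"
    proof (rule fixed_field_of_involution[of F b])
      show "F \<subseteq> {f. \<sigma> f = f}"
        unfolding F_def
        by (intro field_adjoin_minimal subfield_fixed)
          (auto simp: hom_const hom sw mult.commute add.commute simp flip: w_def)
      show "\<sigma> b \<noteq> b"
        using independent_pair_neq[OF K bw] by (simp add: w_def)
    next
      fix E assume E: "subfield E" "F \<subseteq> E" "b \<in> E"
      note R = subringD[OF subfield_imp_subring[OF E(1)]]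
        subring_numeral[OF subfield_imp_subring[OF E(1)]]
      have "b + w \<in> E"
        using E F by blast
      then have "(b + w) - b \<in> E"
        using E(3) by (rule R(5))
      then have "w \<in> E"
        by simp
      then have "(w * (3 * b + 1) ^ 2 - b + 3 * b ^ 2) / (9 * b ^ 2) \<in> E"
        using E by (intro subfield_divide[OF E(1)] R)
      moreover have "(w * (3 * b + 1) ^ 2 - b + 3 * b ^ 2) / (9 * b ^ 2) = c"
        unfolding w[symmetric] using nz nine by simp
      ultimately show "E = UNIV"
        using E F by (intro subfield_eq_UNIV_coords) (auto simp: b_def c_def)
    qed (use F in \<open>simp_all flip: w_def\<close>)
    then show ?thesis
      unfolding F_def by (intro rational_overI[OF K independent_pair_sum_product[OF K bw]])
  next
    case True
    have "(9 :: 'k poly poly fract) = 3 * 3" "(27 :: 'k poly poly fract) = 9 * 3"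
      by simp_all
    then have multiples: "(9 :: 'k poly poly fract) = 0" "(27 :: 'k poly poly fract) = 0"
      using True by (metis mult_zero_right)+
    have "(2 :: 'k poly poly fract) = 3 - 1"
      by simp
    then have two: "(2 :: 'k poly poly fract) = - 1"
      using True by (metis diff_0)
    have char3: "N = - (y ^ 2)" "M = y ^ 2"
      by (simp_all add: N_def M_def True multiples)
    have sb': "\<sigma> b = b"
      unfolding sb char3 using nz by (simp add: b field_simps power2_eq_square)
    have sc': "\<sigma> c = 2 * b + 2 - c"
    proof -
      have "\<sigma> c = (2 * x ^ 2 + 2 * x * y ^ 2 - y ^ 3) / (x * y ^ 2)"
        unfolding sc char3 using nz by (simp add: D_def multiples field_simps power2_eq_square)
      also have "\<dots> = 2 * b + 2 - c"
        using nz by (simp add: b c field_simps power2_eq_square power3_eq_cube)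
      finally show ?thesis .
    qed
    define t where "t = c * \<sigma> c"
    have "coeffs_in (ring_adjoin ?K b) [:0, 2 * b + 2, - 1:]"
      by (intro coeffs_in_pCons coeffs_in_const subring_ring_adjoin K Rb)
    then have "independent_pair ?K b (poly [:0, 2 * b + 2, - 1:] c)"
      by (rule independent_pair_poly[OF K bc]) simp
    moreover have "poly [:0, 2 * b + 2, - 1:] c = t"
      by (simp add: t_def sc' algebra_simps)
    ultimately have bt: "independent_pair ?K b t"
      by simp
    define F where "F = field_adjoin ?K {b, t}"
    have F: "subfield F" "?K \<subseteq> F" "b \<in> F" "t \<in> F"
      unfolding F_def using subfield_field_adjoin field_adjoin_superset by blast+
    have "{f. \<sigma> f = f} = F"
    proof (rule fixed_field_of_involution[of F c])
      show "F \<subseteq> {f. \<sigma> f = f}"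
        unfolding F_def
        by (intro field_adjoin_minimal subfield_fixed)
          (auto simp: hom_const hom sb' sc' t_def)
      have "2 * b + 2 \<in> F"
        using F(3) by (intro subringD[OF subfield_imp_subring[OF F(1)]]
            subring_numeral[OF subfield_imp_subring[OF F(1)]])
      then show "c + \<sigma> c \<in> F"
        by (simp add: sc')
      show "c * \<sigma> c \<in> F"
        using F(4) by (simp add: t_def)
      show "\<sigma> c \<noteq> c"
      proof
        assume "\<sigma> c = c"
        then have "2 * (b + 1) = 2 * c"
          by (simp add: sc' algebra_simps)
        moreover have "(2 :: 'k poly poly fract) \<noteq> 0"
          by (simp add: two)
        ultimately have "c = b + 1"
          by (metis mult_cancel_left)
        moreover have "b + 1 \<in> ring_adjoin ?K b"
          by (intro Rb)
        ultimately show False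
          using transcendental_not_mem[OF subring_ring_adjoin[OF K]
              independent_pair_imp_transcendental[OF K bc]] by simp
      qed
    next
      fix E assume "subfield E" "F \<subseteq> E" "c \<in> E"
      then show "E = UNIV"
        using F by (intro subfield_eq_UNIV_coords) (auto simp: b_def c_def)
    qed (fact F)
    then show ?thesis
      unfolding F_def by (intro rational_overI[OF K bt])
  qed
qed

end
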